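(* Let $(\mathcal{C},\mathcal{M})$ be an AECat with the amalgamation property and $\mathop{\perp\!\!\!\perp}$ a basic independence relation. If $\mathop{\perp\!\!\!\perp}$ satisfies Independence Theorem then it satisfies 3-amalgamation. Conversely, if $\mathop{\perp\!\!\!\perp}$ satisfies 3-amalgamation then it satisfies Independence Theorem over models, i.e. the Independence Theorem property holds for all instances in which the domain of the base arrow $c$ is a model.
   Context: An AECat is a pair $(\mathcal{C},\mathcal{M})$ of accessible categories with $\mathcal{M}$ a full subcategory of $\mathcal{C}$, $\mathcal{M}$ having directed colimits preserved by the inclusion, and every arrow of $\mathcal{C}$ a monomorphism; objects of $\mathcal{M}$ are models. AP: every span of models completes to a commutative square into a model. An extension of a model $M$ is an arrow $M\to N$ with $N$ a model; given it and $a:A\to M$ we also write $a$ for $A\to M\to N$, and subobjects of $M$ are regarded as subobjects of $N$. $(a,b,\dots;M)$ means $M$ is a model and $a,b,\dots$ arrows into $M$. $\mathrm{gtp}((a_i)_i;M)=\mathrm{gtp}((a_i')_i;M')$ means $\mathrm{dom}(a_i)=\mathrm{dom}(a_i')$ and there are extensions $f:M\to N$, $f':M'\to N$ with $fa_i=f'a_i'$ for all $i$. $((a_i)_i/(b_j)_j;M)\sim((a_i')_i/(b_j)_j;M)$ if there are an extension $M\to N$ and $m_0:M_0\to N$ with $M_0$ a model, each $b_j$ factoring through $m_0$, and $\mathrm{gtp}((a_i)_i,m_0;N)=\mathrm{gtp}((a_i')_i,m_0;N)$; its transitive closure is $\mathrm{Lgtp}((a_i)_i/(b_j)_j;M)=\mathrm{Lgtp}((a_i')_i/(b_j)_j;M)$.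 A base class is a collection of objects of $\mathcal{C}$ containing all models. An independence relation is a relation on triples of subobjects of a model $M$, written $A\mathop{\perp\!\!\!\perp}_C^MB$ (arrows may replace the subobjects they represent), with base class $\mathrm{base}(\mathop{\perp\!\!\!\perp})$ meaning $A\mathop{\perp\!\!\!\perp}_C^MB$ implies $\mathrm{dom}(C)\in\mathrm{base}(\mathop{\perp\!\!\!\perp})$. It is basic if it satisfies: Invariance ($a\mathop{\perp\!\!\!\perp}_c^Mb$ and $\mathrm{gtp}(a,b,c;M)=\mathrm{gtp}(a',b',c';M')$ imply $a'\mathop{\perp\!\!\!\perp}_{c'}^{M'}b'$); Monotonicity ($A\mathop{\perp\!\!\!\perp}_C^MB$, $A'\le A$ imply $A'\mathop{\perp\!\!\!\perp}_C^MB$); Transitivity ($A\mathop{\perp\!\!\!\perp}_B^MC$, $A\mathop{\perp\!\!\!\perp}_C^MD$, $B\le C$ imply $A\mathop{\perp\!\!\!\perp}_B^MD$); Symmetry; Existence ($A\mathop{\perp\!\!\!\perp}_C^MC$ for $C$ in the base class); Extension (if $a\mathop{\perp\!\!\!\perp}_c^Mb$ and $b$ factors through $(b';M)$, there are an extension $M\to N$ and $(a';N)$ with $\mathrm{gtp}(a',b,c;N)=\mathrm{gtp}(a,b,c;M)$ and $a'\mathop{\perp\!\!\!\perp}_c^Nb'$); Union (if $(B_i)_{i\in I}$ is directed with a cocone into a model $M$ and $B=\mathrm{colim}_iB_i$ exists, then $A\mathop{\perp\!\!\!\perp}_C^MB_i$ for all $i$ implies $A\mathop{\perp\!\!\!\perp}_C^MB$).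 Independence Theorem: if $a\mathop{\perp\!\!\!\perp}_c^Mb$, $a'\mathop{\perp\!\!\!\perp}_c^Mb'$, $b\mathop{\perp\!\!\!\perp}_c^Mb'$ and $\mathrm{Lgtp}(a/c;M)=\mathrm{Lgtp}(a'/c;M)$, there are an extension $M\to N$ and $(a^*;N)$ with $\mathrm{Lgtp}(a^*,b/c;N)=\mathrm{Lgtp}(a,b/c;N)$, $\mathrm{Lgtp}(a^*,b'/c;N)=\mathrm{Lgtp}(a',b'/c;N)$ and $a^*\mathop{\perp\!\!\!\perp}_c^NM$. 3-amalgamation: whenever $M,N_1,N_2,N_3$ are models and $a_1:A\to N_1$, $a_3:A\to N_3$, $b_1:B\to N_1$, $b_2:B\to N_2$, $c_2:C\to N_2$, $c_3:C\to N_3$, $m_k:M\to N_k$ ($k=1,2,3$) are arrows with $a_1\mathop{\perp\!\!\!\perp}_{m_1}^{N_1}b_1$, $b_2\mathop{\perp\!\!\!\perp}_{m_2}^{N_2}c_2$, $c_3\mathop{\perp\!\!\!\perp}_{m_3}^{N_3}a_3$, $\mathrm{gtp}(a_1,m_1;N_1)=\mathrm{gtp}(a_3,m_3;N_3)$, $\mathrm{gtp}(b_1,m_1;N_1)=\mathrm{gtp}(b_2,m_2;N_2)$, $\mathrm{gtp}(c_2,m_2;N_2)=\mathrm{gtp}(c_3,m_3;N_3)$, there are a model $N$ and arrows $f_k:N_k\to N$ with $f_1m_1=f_2m_2=f_3m_3$, $f_1a_1=f_3a_3$, $f_1b_1=f_2b_2$, $f_2c_2=f_3c_3$, and $f_1a_1\mathop{\perp\!\!\!\perp}_{f_1m_1}^{N}f_2$.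 *)

theory Defs
  imports Main
begin

unbundle cardinal_syntax

section \<open>Categories\<close>

record ('o, 'a) category =
  Obj :: "'o set"
  Arr :: "'a set"
  Dom :: "'a \<Rightarrow> 'o"
  Cod :: "'a \<Rightarrow> 'o"
  Ident :: "'o \<Rightarrow> 'a"
  Comp :: "'a \<Rightarrow> 'a \<Rightarrow> 'a"  (infixr "\<cdot>\<index>" 70)

definition hom :: "('o, 'a) category \<Rightarrow> 'o \<Rightarrow> 'o \<Rightarrow> 'a set" where
  "hom C X Y = {f \<in> Arr C. Dom C f = X \<and> Cod C f = Y}"

definition is_category :: "('o, 'a) category \<Rightarrow> bool" where
  "is_category C \<longleftrightarrow>
     (\<forall>f \<in> Arr C. Dom C f \<in> Obj C \<and> Cod C f \<in> Obj C) \<and>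
     (\<forall>X \<in> Obj C. Ident C X \<in> hom C X X) \<and>
     (\<forall>f \<in> Arr C. \<forall>g \<in> Arr C. Cod C f = Dom C g \<longrightarrow>
        g \<cdot>\<^bsub>C\<^esub> f \<in> hom C (Dom C f) (Cod C g)) \<and>
     (\<forall>f \<in> Arr C. f \<cdot>\<^bsub>C\<^esub> Ident C (Dom C f) = f \<and> Ident C (Cod C f) \<cdot>\<^bsub>C\<^esub> f = f) \<and>
     (\<forall>f \<in> Arr C. \<forall>g \<in> Arr C. \<forall>h \<in> Arr C. Cod C f = Dom C g \<longrightarrow> Cod C g = Dom C h \<longrightarrow>
        (h \<cdot>\<^bsub>C\<^esub> g) \<cdot>\<^bsub>C\<^esub> f = h \<cdot>\<^bsub>C\<^esub> (g \<cdot>\<^bsub>C\<^esub> f))"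

definition mono_arrow :: "('o, 'a) category \<Rightarrow> 'a \<Rightarrow> bool" where
  "mono_arrow C f \<longleftrightarrow> f \<in> Arr C \<and>
     (\<forall>X. \<forall>g \<in> hom C X (Dom C f). \<forall>h \<in> hom C X (Dom C f). f \<cdot>\<^bsub>C\<^esub> g = f \<cdot>\<^bsub>C\<^esub> h \<longrightarrow> g = h)"

definition full_subcategory :: "('o, 'a) category \<Rightarrow> 'o set \<Rightarrow> ('o, 'a) category" where
  "full_subcategory C S =
     C\<lparr>Obj := S, Arr := {f \<in> Arr C. Dom C f \<in> S \<and> Cod C f \<in> S}\<rparr>"


section \<open>Directed diagrams and their colimits\<close>

text \<open>
  A poset is a relation \<open>r\<close> with underlying set \<open>Field r\<close>. It is directed with respect to a
  cardinal \<open>k\<close> if every subset of size less than \<open>k\<close> has an upper bound; for \<open>k = natLeq\<close>, i.e.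
  aleph-0, this is directedness in the ordinary sense. The empty poset is not directed.
\<close>

definition directed_poset :: "'k rel \<Rightarrow> 'i rel \<Rightarrow> bool" where
  "directed_poset k r \<longleftrightarrow> Partial_order r \<and>
     (\<forall>J \<subseteq> Field r. |J| <o k \<longrightarrow> (\<exists>i \<in> Field r. \<forall>j \<in> J. (j, i) \<in> r))"

definition diagram ::
  "('o, 'a) category \<Rightarrow> 'i rel \<Rightarrow> ('i \<Rightarrow> 'o) \<Rightarrow> ('i \<Rightarrow> 'i \<Rightarrow> 'a) \<Rightarrow> bool" where
  "diagram C r D d \<longleftrightarrow>
     (\<forall>i \<in> Field r. D i \<in> Obj C \<and> d i i = Ident C (D i)) \<and>
     (\<forall>i j. (i, j) \<in> r \<longrightarrow> d i j \<in> hom C (D i) (D j)) \<and>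
     (\<forall>i j k. (i, j) \<in> r \<longrightarrow> (j, k) \<in> r \<longrightarrow> d j k \<cdot>\<^bsub>C\<^esub> d i j = d i k)"

definition cocone ::
  "('o, 'a) category \<Rightarrow> 'i rel \<Rightarrow> ('i \<Rightarrow> 'o) \<Rightarrow> ('i \<Rightarrow> 'i \<Rightarrow> 'a) \<Rightarrow> 'o \<Rightarrow> ('i \<Rightarrow> 'a) \<Rightarrow> bool" where
  "cocone C r D d X l \<longleftrightarrow> X \<in> Obj C \<and>
     (\<forall>i \<in> Field r. l i \<in> hom C (D i) X) \<and>
     (\<forall>i j. (i, j) \<in> r \<longrightarrow> l j \<cdot>\<^bsub>C\<^esub> d i j = l i)"

definition colimit ::
  "('o, 'a) category \<Rightarrow> 'i rel \<Rightarrow> ('i \<Rightarrow> 'o) \<Rightarrow> ('i \<Rightarrow> 'i \<Rightarrow> 'a) \<Rightarrow> 'o \<Rightarrow> ('i \<Rightarrow> 'a) \<Rightarrow> bool" where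
  "colimit C r D d X l \<longleftrightarrow> cocone C r D d X l \<and>
     (\<forall>Y l'. cocone C r D d Y l' \<longrightarrow>
        (\<exists>!u. u \<in> hom C X Y \<and> (\<forall>i \<in> Field r. u \<cdot>\<^bsub>C\<^esub> l i = l' i)))"


section \<open>Accessible categories\<close>

text \<open>
  Size is measured by a type \<open>'u\<close>: a set is small if it has fewer elements than \<open>'u\<close>, and every
  other set plays the role of a possibly proper class. When the cardinality of \<open>'u\<close> is strongly
  inaccessible this is the usual distinction relative to a Grothendieck universe. No closure
  property of that cardinality is imposed, so a statement quantified over \<open>'u\<close> includes this case.
  Up to isomorphism, every small poset is a relation on \<open>'u\<close>, and every small cardinal is
  represented on \<open>'u\<close>.
\<close>

definition small :: "'u itself \<Rightarrow> 'x set \<Rightarrow> bool" where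
  "small _ A \<longleftrightarrow> |A| <o |UNIV :: 'u set|"

definition has_directed_colimits :: "'u itself \<Rightarrow> 'k rel \<Rightarrow> ('o, 'a) category \<Rightarrow> bool" where
  "has_directed_colimits U k C \<longleftrightarrow>
     (\<forall>(r :: 'u rel) D d. small U (Field r) \<longrightarrow> directed_poset k r \<longrightarrow> diagram C r D d \<longrightarrow>
        (\<exists>X l. colimit C r D d X l))"

text \<open>
  \<open>X\<close> is \<open>k\<close>-presentable if \<open>hom(X, -)\<close> preserves \<open>k\<close>-directed colimits. A directed colimit of sets
  is the disjoint union modulo eventual equality, so this says that the canonical map from the
  colimit of the sets \<open>hom(X, D i)\<close> to \<open>hom(X, Y)\<close> is surjective and injective.
\<close>

definition presentable :: "'u itself \<Rightarrow> 'k rel \<Rightarrow> ('o, 'a) category \<Rightarrow> 'o \<Rightarrow> bool" where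
  "presentable U k C X \<longleftrightarrow> X \<in> Obj C \<and>
     (\<forall>(r :: 'u rel) D d Y l. small U (Field r) \<longrightarrow> directed_poset k r \<longrightarrow> diagram C r D d \<longrightarrow>
        colimit C r D d Y l \<longrightarrow>
        (\<forall>f \<in> hom C X Y. \<exists>i \<in> Field r. \<exists>g \<in> hom C X (D i). l i \<cdot>\<^bsub>C\<^esub> g = f) \<and>
        (\<forall>i \<in> Field r. \<forall>j \<in> Field r. \<forall>g \<in> hom C X (D i). \<forall>h \<in> hom C X (D j).
           l i \<cdot>\<^bsub>C\<^esub> g = l j \<cdot>\<^bsub>C\<^esub> h \<longrightarrow>
           (\<exists>k. (i, k) \<in> r \<and> (j, k) \<in> r \<and> d i k \<cdot>\<^bsub>C\<^esub> g = d j k \<cdot>\<^bsub>C\<^esub> h)))"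

definition accessible_for :: "'u itself \<Rightarrow> 'u rel \<Rightarrow> ('o, 'a) category \<Rightarrow> bool" where
  "accessible_for U k C \<longleftrightarrow> has_directed_colimits U k C \<and>
     (\<exists>S. small U S \<and> (\<forall>P \<in> S. presentable U k C P) \<and>
        (\<forall>X \<in> Obj C. \<exists>(r :: 'u rel) D d l. small U (Field r) \<and> directed_poset k r \<and>
           diagram C r D d \<and> (\<forall>i \<in> Field r. D i \<in> S) \<and> colimit C r D d X l))"

definition accessible :: "'u itself \<Rightarrow> ('o, 'a) category \<Rightarrow> bool" where
  "accessible U C \<longleftrightarrow> is_category C \<and>
     (\<forall>X \<in> Obj C. \<forall>Y \<in> Obj C. small U (hom C X Y)) \<and>
     (\<exists>k :: 'u rel. Card_order k \<and> cinfinite k \<and> regularCard k \<and> small U (Field k) \<and>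
        accessible_for U k C)"


section \<open>Abstract elementary categories\<close>

text \<open>The second component of the pair is given by its set \<open>Ms\<close> of objects, the models.\<close>

definition AECat :: "'u itself \<Rightarrow> ('o, 'a) category \<Rightarrow> 'o set \<Rightarrow> bool" where
  "AECat U C Ms \<longleftrightarrow> accessible U C \<and> Ms \<subseteq> Obj C \<and> accessible U (full_subcategory C Ms) \<and>
     has_directed_colimits U natLeq (full_subcategory C Ms) \<and>
     (\<forall>(r :: 'u rel) D d X l. small U (Field r) \<longrightarrow> directed_poset natLeq r \<longrightarrow>
        diagram (full_subcategory C Ms) r D d \<longrightarrow>
        colimit (full_subcategory C Ms) r D d X l \<longrightarrow> colimit C r D d X l) \<and>
     (\<forall>f \<in> Arr C. mono_arrow C f)"

definition amalgamation_property :: "('o, 'a) category \<Rightarrow> 'o set \<Rightarrow> bool" where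
  "amalgamation_property C Ms \<longleftrightarrow>
     (\<forall>M \<in> Ms. \<forall>M1 \<in> Ms. \<forall>M2 \<in> Ms. \<forall>f1 \<in> hom C M M1. \<forall>f2 \<in> hom C M M2.
        \<exists>N \<in> Ms. \<exists>g1 \<in> hom C M1 N. \<exists>g2 \<in> hom C M2 N. g1 \<cdot>\<^bsub>C\<^esub> f1 = g2 \<cdot>\<^bsub>C\<^esub> f2)"

definition arrows_into :: "('o, 'a) category \<Rightarrow> 'o \<Rightarrow> 'a set" where
  "arrows_into C M = {a \<in> Arr C. Cod C a = M}"

definition factors_through :: "('o, 'a) category \<Rightarrow> 'a \<Rightarrow> 'a \<Rightarrow> bool" where
  "factors_through C a b \<longleftrightarrow> (\<exists>h \<in> hom C (Dom C a) (Dom C b). a = b \<cdot>\<^bsub>C\<^esub> h)"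


section \<open>Galois types and Lascar strong Galois types\<close>

text \<open>
  Families of arrows into a model are given as lists. Along an extension \<open>f\<close> of the model, an
  arrow \<open>a\<close> becomes \<open>f \<cdot> a\<close>; this is written out everywhere below.
\<close>

definition gtp_eq :: "('o, 'a) category \<Rightarrow> 'o set \<Rightarrow> 'o \<Rightarrow> 'a list \<Rightarrow> 'o \<Rightarrow> 'a list \<Rightarrow> bool" where
  "gtp_eq C Ms M as M' as' \<longleftrightarrow> M \<in> Ms \<and> M' \<in> Ms \<and>
     set as \<subseteq> arrows_into C M \<and> set as' \<subseteq> arrows_into C M' \<and>
     map (Dom C) as = map (Dom C) as' \<and>
     (\<exists>N \<in> Ms. \<exists>f \<in> hom C M N. \<exists>f' \<in> hom C M' N.
        map (\<lambda>a. f \<cdot>\<^bsub>C\<^esub> a) as = map (\<lambda>a. f' \<cdot>\<^bsub>C\<^esub> a) as')"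

definition Lgtp_step ::
  "('o, 'a) category \<Rightarrow> 'o set \<Rightarrow> 'o \<Rightarrow> 'a list \<Rightarrow> 'a list \<Rightarrow> 'a list \<Rightarrow> bool" where
  "Lgtp_step C Ms M bs as as' \<longleftrightarrow> M \<in> Ms \<and>
     set as \<subseteq> arrows_into C M \<and> set as' \<subseteq> arrows_into C M \<and> set bs \<subseteq> arrows_into C M \<and>
     (\<exists>N \<in> Ms. \<exists>e \<in> hom C M N. \<exists>M0 \<in> Ms. \<exists>m0 \<in> hom C M0 N.
        (\<forall>b \<in> set bs. factors_through C (e \<cdot>\<^bsub>C\<^esub> b) m0) \<and>
        gtp_eq C Ms N (map (\<lambda>a. e \<cdot>\<^bsub>C\<^esub> a) as @ [m0]) N (map (\<lambda>a. e \<cdot>\<^bsub>C\<^esub> a) as' @ [m0]))"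

definition Lgtp_eq ::
  "('o, 'a) category \<Rightarrow> 'o set \<Rightarrow> 'o \<Rightarrow> 'a list \<Rightarrow> 'a list \<Rightarrow> 'a list \<Rightarrow> bool" where
  "Lgtp_eq C Ms M bs = tranclp (Lgtp_step C Ms M bs)"


section \<open>Independence relations\<close>

text \<open>
  \<open>ind M a c b\<close> stands for: \<open>a\<close> is independent from \<open>b\<close> over \<open>c\<close> in \<open>M\<close>. A relation on subobjects
  of \<open>M\<close> is given as a relation on arrows into \<open>M\<close> (all of which are monomorphisms) that depends
  only on the represented subobjects.
\<close>

type_synonym ('o, 'a) indep = "'o \<Rightarrow> 'a \<Rightarrow> 'a \<Rightarrow> 'a \<Rightarrow> bool"

definition same_subobject :: "('o, 'a) category \<Rightarrow> 'a \<Rightarrow> 'a \<Rightarrow> bool" where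
  "same_subobject C a b \<longleftrightarrow> factors_through C a b \<and> factors_through C b a"

definition base_class :: "('o, 'a) category \<Rightarrow> 'o set \<Rightarrow> 'o set \<Rightarrow> bool" where
  "base_class C Ms base \<longleftrightarrow> Ms \<subseteq> base \<and> base \<subseteq> Obj C"

definition independence_relation ::
  "('o, 'a) category \<Rightarrow> 'o set \<Rightarrow> 'o set \<Rightarrow> ('o, 'a) indep \<Rightarrow> bool" where
  "independence_relation C Ms base ind \<longleftrightarrow> base_class C Ms base \<and>
     (\<forall>M a c b. ind M a c b \<longrightarrow> M \<in> Ms \<and> a \<in> arrows_into C M \<and> c \<in> arrows_into C M \<and>
        b \<in> arrows_into C M \<and> Dom C c \<in> base) \<and>
     (\<forall>M. \<forall>a \<in> arrows_into C M. \<forall>a' \<in> arrows_into C M. \<forall>c \<in> arrows_into C M.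
        \<forall>c' \<in> arrows_into C M. \<forall>b \<in> arrows_into C M. \<forall>b' \<in> arrows_into C M.
        same_subobject C a a' \<longrightarrow> same_subobject C c c' \<longrightarrow> same_subobject C b b' \<longrightarrow>
        ind M a c b \<longrightarrow> ind M a' c' b')"

definition ind_invariance :: "('o, 'a) category \<Rightarrow> 'o set \<Rightarrow> ('o, 'a) indep \<Rightarrow> bool" where
  "ind_invariance C Ms ind \<longleftrightarrow>
     (\<forall>M a b c M' a' b' c'. ind M a c b \<longrightarrow> gtp_eq C Ms M [a, b, c] M' [a', b', c'] \<longrightarrow>
        ind M' a' c' b')"

definition ind_monotonicity :: "('o, 'a) category \<Rightarrow> ('o, 'a) indep \<Rightarrow> bool" where
  "ind_monotonicity C ind \<longleftrightarrow>
     (\<forall>M a c b. \<forall>a' \<in> arrows_into C M. ind M a c b \<longrightarrow> factors_through C a' a \<longrightarrow> ind M a' c b)"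

definition ind_transitivity :: "('o, 'a) category \<Rightarrow> ('o, 'a) indep \<Rightarrow> bool" where
  "ind_transitivity C ind \<longleftrightarrow>
     (\<forall>M a b c d. ind M a b c \<longrightarrow> ind M a c d \<longrightarrow> factors_through C b c \<longrightarrow> ind M a b d)"

definition ind_symmetry :: "('o, 'a) indep \<Rightarrow> bool" where
  "ind_symmetry ind \<longleftrightarrow> (\<forall>M a c b. ind M a c b \<longrightarrow> ind M b c a)"

definition ind_existence ::
  "('o, 'a) category \<Rightarrow> 'o set \<Rightarrow> 'o set \<Rightarrow> ('o, 'a) indep \<Rightarrow> bool" where
  "ind_existence C Ms base ind \<longleftrightarrow>
     (\<forall>M \<in> Ms. \<forall>a \<in> arrows_into C M. \<forall>c \<in> arrows_into C M. Dom C c \<in> base \<longrightarrow> ind M a c c)"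

definition ind_extension :: "('o, 'a) category \<Rightarrow> 'o set \<Rightarrow> ('o, 'a) indep \<Rightarrow> bool" where
  "ind_extension C Ms ind \<longleftrightarrow>
     (\<forall>M a c b. \<forall>b' \<in> arrows_into C M. ind M a c b \<longrightarrow> factors_through C b b' \<longrightarrow>
        (\<exists>N \<in> Ms. \<exists>e \<in> hom C M N. \<exists>a' \<in> arrows_into C N.
           gtp_eq C Ms N [a', e \<cdot>\<^bsub>C\<^esub> b, e \<cdot>\<^bsub>C\<^esub> c] M [a, b, c] \<and>
           ind N a' (e \<cdot>\<^bsub>C\<^esub> c) (e \<cdot>\<^bsub>C\<^esub> b')))"

text \<open>
  In the following, \<open>u\<close> is the arrow induced by the cocone \<open>l'\<close> into \<open>M\<close>; it represents the
  colimit as a subobject of \<open>M\<close>. The diagram consists of objects of the ambient category, and its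
  colimit is not required to exist in general.
\<close>

definition ind_union ::
  "'u itself \<Rightarrow> ('o, 'a) category \<Rightarrow> 'o set \<Rightarrow> ('o, 'a) indep \<Rightarrow> bool" where
  "ind_union U C Ms ind \<longleftrightarrow>
     (\<forall>(r :: 'u rel) D d M l' X l u a c. small U (Field r) \<longrightarrow> directed_poset natLeq r \<longrightarrow>
        diagram C r D d \<longrightarrow> M \<in> Ms \<longrightarrow> cocone C r D d M l' \<longrightarrow> colimit C r D d X l \<longrightarrow>
        u \<in> hom C X M \<longrightarrow> (\<forall>i \<in> Field r. u \<cdot>\<^bsub>C\<^esub> l i = l' i) \<longrightarrow>
        (\<forall>i \<in> Field r. ind M a c (l' i)) \<longrightarrow> ind M a c u)"

definition basic_independence_relation ::
  "'u itself \<Rightarrow> ('o, 'a) category \<Rightarrow> 'o set \<Rightarrow> 'o set \<Rightarrow> ('o, 'a) indep \<Rightarrow> bool" where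
  "basic_independence_relation U C Ms base ind \<longleftrightarrow>
     independence_relation C Ms base ind \<and> ind_invariance C Ms ind \<and>
     ind_monotonicity C ind \<and> ind_transitivity C ind \<and> ind_symmetry ind \<and>
     ind_existence C Ms base ind \<and> ind_extension C Ms ind \<and> ind_union U C Ms ind"

definition independence_theorem_at ::
  "('o, 'a) category \<Rightarrow> 'o set \<Rightarrow> ('o, 'a) indep \<Rightarrow> 'a \<Rightarrow> bool" where
  "independence_theorem_at C Ms ind c \<longleftrightarrow>
     (\<forall>M a a' b b'. ind M a c b \<longrightarrow> ind M a' c b' \<longrightarrow> ind M b c b' \<longrightarrow>
        Lgtp_eq C Ms M [c] [a] [a'] \<longrightarrow>
        (\<exists>N \<in> Ms. \<exists>e \<in> hom C M N. \<exists>a0 \<in> arrows_into C N.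
           Lgtp_eq C Ms N [e \<cdot>\<^bsub>C\<^esub> c] [a0, e \<cdot>\<^bsub>C\<^esub> b] [e \<cdot>\<^bsub>C\<^esub> a, e \<cdot>\<^bsub>C\<^esub> b] \<and>
           Lgtp_eq C Ms N [e \<cdot>\<^bsub>C\<^esub> c] [a0, e \<cdot>\<^bsub>C\<^esub> b'] [e \<cdot>\<^bsub>C\<^esub> a', e \<cdot>\<^bsub>C\<^esub> b'] \<and>
           ind N a0 (e \<cdot>\<^bsub>C\<^esub> c) e))"

definition independence_theorem ::
  "('o, 'a) category \<Rightarrow> 'o set \<Rightarrow> ('o, 'a) indep \<Rightarrow> bool" where
  "independence_theorem C Ms ind \<longleftrightarrow> (\<forall>c \<in> Arr C. independence_theorem_at C Ms ind c)"

definition independence_theorem_over_models ::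
  "('o, 'a) category \<Rightarrow> 'o set \<Rightarrow> ('o, 'a) indep \<Rightarrow> bool" where
  "independence_theorem_over_models C Ms ind \<longleftrightarrow>
     (\<forall>c \<in> Arr C. Dom C c \<in> Ms \<longrightarrow> independence_theorem_at C Ms ind c)"

definition three_amalgamation ::
  "('o, 'a) category \<Rightarrow> 'o set \<Rightarrow> ('o, 'a) indep \<Rightarrow> bool" where
  "three_amalgamation C Ms ind \<longleftrightarrow>
     (\<forall>M \<in> Ms. \<forall>N1 \<in> Ms. \<forall>N2 \<in> Ms. \<forall>N3 \<in> Ms. \<forall>A \<in> Obj C. \<forall>B \<in> Obj C. \<forall>X \<in> Obj C.
      \<forall>a1 \<in> hom C A N1. \<forall>a3 \<in> hom C A N3. \<forall>b1 \<in> hom C B N1. \<forall>b2 \<in> hom C B N2.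
      \<forall>c2 \<in> hom C X N2. \<forall>c3 \<in> hom C X N3.
      \<forall>m1 \<in> hom C M N1. \<forall>m2 \<in> hom C M N2. \<forall>m3 \<in> hom C M N3.
        ind N1 a1 m1 b1 \<longrightarrow> ind N2 b2 m2 c2 \<longrightarrow> ind N3 c3 m3 a3 \<longrightarrow>
        gtp_eq C Ms N1 [a1, m1] N3 [a3, m3] \<longrightarrow>
        gtp_eq C Ms N1 [b1, m1] N2 [b2, m2] \<longrightarrow>
        gtp_eq C Ms N2 [c2, m2] N3 [c3, m3] \<longrightarrow>
        (\<exists>N \<in> Ms. \<exists>f1 \<in> hom C N1 N. \<exists>f2 \<in> hom C N2 N. \<exists>f3 \<in> hom C N3 N.
           f1 \<cdot>\<^bsub>C\<^esub> m1 = f2 \<cdot>\<^bsub>C\<^esub> m2 \<and> f2 \<cdot>\<^bsub>C\<^esub> m2 = f3 \<cdot>\<^bsub>C\<^esub> m3 \<and>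
           f1 \<cdot>\<^bsub>C\<^esub> a1 = f3 \<cdot>\<^bsub>C\<^esub> a3 \<and> f1 \<cdot>\<^bsub>C\<^esub> b1 = f2 \<cdot>\<^bsub>C\<^esub> b2 \<and> f2 \<cdot>\<^bsub>C\<^esub> c2 = f3 \<cdot>\<^bsub>C\<^esub> c3 \<and>
           ind N (f1 \<cdot>\<^bsub>C\<^esub> a1) (f1 \<cdot>\<^bsub>C\<^esub> m1) f2))"

end

theory Submission
  imports Defs
begin

text \<open>
  Over a base \<open>m\<close> whose domain is a model, the Lascar strong type of a family is just the Galois
  type of the family together with \<open>m\<close>. Hence the Independence Theorem yields 3-amalgamation by
  first amalgamating \<open>N1\<close>, \<open>N2\<close>, \<open>N3\<close> along their common parts, except that the two copies of \<open>A\<close>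
  are left apart, and then replacing both copies by a single independent realisation.
  Conversely, the Independence Theorem over a model in \<open>M\<close> is 3-amalgamation with
  \<open>N1 = N2 = N3 = M\<close>, the extension being \<open>f2\<close> and the new realisation \<open>f1 a\<close>.
\<close>

section \<open>Galois types and Lascar strong types when models amalgamate\<close>

locale amalgamation_category =
  fixes C :: "('o, 'a) category" and Ms :: "'o set"
  assumes category: "is_category C"
    and models_Obj: "Ms \<subseteq> Obj C"
    and amalgamation: "amalgamation_property C Ms"
begin

lemma comp_hom: "f \<in> hom C X Y \<Longrightarrow> g \<in> hom C Y Z \<Longrightarrow> g \<cdot>\<^bsub>C\<^esub> f \<in> hom C X Z"
  using category unfolding is_category_def hom_def by auto

lemma comp_arrows_into: "a \<in> arrows_into C M \<Longrightarrow> f \<in> hom C M N \<Longrightarrow> f \<cdot>\<^bsub>C\<^esub> a \<in> arrows_into C N"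
  using comp_hom unfolding arrows_into_def hom_def by blast

lemma Dom_comp: "a \<in> arrows_into C M \<Longrightarrow> f \<in> hom C M N \<Longrightarrow> Dom C (f \<cdot>\<^bsub>C\<^esub> a) = Dom C a"
  using category unfolding is_category_def hom_def arrows_into_def by auto

lemma comp_assoc:
  "a \<in> arrows_into C M \<Longrightarrow> f \<in> hom C M N \<Longrightarrow> g \<in> hom C N K \<Longrightarrow>
    (g \<cdot>\<^bsub>C\<^esub> f) \<cdot>\<^bsub>C\<^esub> a = g \<cdot>\<^bsub>C\<^esub> (f \<cdot>\<^bsub>C\<^esub> a)"
  using category unfolding is_category_def hom_def arrows_into_def by auto

lemma hom_arrows_into: "f \<in> hom C X Y \<Longrightarrow> f \<in> arrows_into C Y"
  unfolding hom_def arrows_into_def by auto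

lemma arrows_into_hom: "a \<in> arrows_into C M \<Longrightarrow> a \<in> hom C (Dom C a) M"
  unfolding hom_def arrows_into_def by auto

lemma Ident_hom: "X \<in> Obj C \<Longrightarrow> Ident C X \<in> hom C X X"
  using category unfolding is_category_def by auto

lemma Ident_comp: "a \<in> arrows_into C M \<Longrightarrow> Ident C M \<cdot>\<^bsub>C\<^esub> a = a"
  using category unfolding is_category_def arrows_into_def by auto

lemma comp_Ident: "a \<in> arrows_into C M \<Longrightarrow> a \<cdot>\<^bsub>C\<^esub> Ident C (Dom C a) = a"
  using category unfolding is_category_def arrows_into_def by auto

lemma amalgamate:
  assumes "f1 \<in> hom C M M1" "f2 \<in> hom C M M2" "M \<in> Ms" "M1 \<in> Ms" "M2 \<in> Ms"
  obtains N g1 g2 where "N \<in> Ms" "g1 \<in> hom C M1 N" "g2 \<in> hom C M2 N"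
    "g1 \<cdot>\<^bsub>C\<^esub> f1 = g2 \<cdot>\<^bsub>C\<^esub> f2"
  using amalgamation assms unfolding amalgamation_property_def by meson

text \<open>The witnesses are \<open>f\<close> and the identity of \<open>N\<close>, with
  \<open>N\<close> as the common extension. This allows types to be computed in whichever extension
  is convenient.\<close>

lemma gtp_eq_extend:
  assumes "M \<in> Ms" "N \<in> Ms" "f \<in> hom C M N" "set as \<subseteq> arrows_into C M"
  shows "gtp_eq C Ms M as N (map (\<lambda>a. f \<cdot>\<^bsub>C\<^esub> a) as)"
proof -
  have "map (\<lambda>a. f \<cdot>\<^bsub>C\<^esub> a) as = map (\<lambda>a. Ident C N \<cdot>\<^bsub>C\<^esub> a) (map (\<lambda>a. f \<cdot>\<^bsub>C\<^esub> a) as)"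
    using assms by (auto intro!: Ident_comp[symmetric] comp_arrows_into)
  moreover have "Ident C N \<in> hom C N N"
    using Ident_hom assms(2) models_Obj by auto
  moreover have "map (Dom C) as = map (Dom C) (map (\<lambda>a. f \<cdot>\<^bsub>C\<^esub> a) as)"
    using assms(3,4) Dom_comp by (auto simp: subset_iff)
  moreover have "set (map (\<lambda>a. f \<cdot>\<^bsub>C\<^esub> a) as) \<subseteq> arrows_into C N"
    using assms comp_arrows_into by auto
  ultimately show ?thesis
    using assms unfolding gtp_eq_def by blast
qed

lemma gtp_eq_sym: "gtp_eq C Ms M as N bs \<Longrightarrow> gtp_eq C Ms N bs M as"
  unfolding gtp_eq_def by metis

text \<open>The models witnessing the two equalities both extend the middle model \<open>N\<close>;
  amalgamating them over \<open>N\<close> yields one model in which both equalities hold at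
  once.\<close>

lemma gtp_eq_trans:
  assumes "gtp_eq C Ms M as N bs" "gtp_eq C Ms N bs K cs"
  shows "gtp_eq C Ms M as K cs"
proof -
  obtain P f f' where 1: "P \<in> Ms" "f \<in> hom C M P" "f' \<in> hom C N P"
    "map (\<lambda>a. f \<cdot>\<^bsub>C\<^esub> a) as = map (\<lambda>a. f' \<cdot>\<^bsub>C\<^esub> a) bs"
    using assms(1) unfolding gtp_eq_def by blast
  obtain Q g g' where 2: "Q \<in> Ms" "g \<in> hom C N Q" "g' \<in> hom C K Q"
    "map (\<lambda>a. g \<cdot>\<^bsub>C\<^esub> a) bs = map (\<lambda>a. g' \<cdot>\<^bsub>C\<^esub> a) cs"
    using assms(2) unfolding gtp_eq_def by blast
  have sets: "M \<in> Ms" "N \<in> Ms" "K \<in> Ms" "set as \<subseteq> arrows_into C M" "set bs \<subseteq> arrows_into C N"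
    "set cs \<subseteq> arrows_into C K" "map (Dom C) as = map (Dom C) cs"
    using assms unfolding gtp_eq_def by auto
  obtain R h k where 3: "R \<in> Ms" "h \<in> hom C P R" "k \<in> hom C Q R"
    "h \<cdot>\<^bsub>C\<^esub> f' = k \<cdot>\<^bsub>C\<^esub> g"
    using amalgamate[OF 1(3) 2(2) sets(2) 1(1) 2(1)] by blast
  have assoc: "map (\<lambda>a. (v \<cdot>\<^bsub>C\<^esub> u) \<cdot>\<^bsub>C\<^esub> a) xs = map (\<lambda>a. v \<cdot>\<^bsub>C\<^esub> a) (map (\<lambda>a. u \<cdot>\<^bsub>C\<^esub> a) xs)"
    if "u \<in> hom C X Y" "v \<in> hom C Y Z" "set xs \<subseteq> arrows_into C X" for u v X Y Z xs
    using comp_assoc that by (auto simp: subset_iff)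
  have "map (\<lambda>a. (h \<cdot>\<^bsub>C\<^esub> f) \<cdot>\<^bsub>C\<^esub> a) as = map (\<lambda>a. (h \<cdot>\<^bsub>C\<^esub> f') \<cdot>\<^bsub>C\<^esub> a) bs"
    using assoc[OF 1(2) 3(2) sets(4)] assoc[OF 1(3) 3(2) sets(5)] 1(4) by argo
  also have "\<dots> = map (\<lambda>a. (k \<cdot>\<^bsub>C\<^esub> g') \<cdot>\<^bsub>C\<^esub> a) cs"
    using assoc[OF 2(2) 3(3) sets(5)] assoc[OF 2(3) 3(3) sets(6)] 2(4) 3(4) by argo
  finally show ?thesis
    unfolding gtp_eq_def using sets 3(1) comp_hom[OF 1(2) 3(2)] comp_hom[OF 2(3) 3(3)] by blast
qed

text \<open>In the extension \<open>N\<close> the base \<open>m\<close> factors through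
  \<open>m0\<close>. Two arrows out of \<open>N\<close> that agree on \<open>m0\<close> therefore
  agree on the image of \<open>m\<close>, and precomposing them with \<open>e\<close> gives
  witnesses over \<open>M\<close>.\<close>

lemma Lgtp_step_imp_gtp_eq:
  assumes "Lgtp_step C Ms M [m] as as'"
  shows "gtp_eq C Ms M (as @ [m]) M (as' @ [m])"
proof -
  obtain N e M0 m0 where N: "N \<in> Ms" "e \<in> hom C M N" "m0 \<in> hom C M0 N"
    and fac: "factors_through C (e \<cdot>\<^bsub>C\<^esub> m) m0"
    and gtp: "gtp_eq C Ms N (map (\<lambda>a. e \<cdot>\<^bsub>C\<^esub> a) as @ [m0]) N (map (\<lambda>a. e \<cdot>\<^bsub>C\<^esub> a) as' @ [m0])"
    using assms unfolding Lgtp_step_def by auto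
  have M: "M \<in> Ms" "set as \<subseteq> arrows_into C M" "set as' \<subseteq> arrows_into C M" "m \<in> arrows_into C M"
    using assms unfolding Lgtp_step_def by auto
  obtain K f f' where K: "K \<in> Ms" "f \<in> hom C N K" "f' \<in> hom C N K"
    and eq: "map (\<lambda>a. f \<cdot>\<^bsub>C\<^esub> (e \<cdot>\<^bsub>C\<^esub> a)) as = map (\<lambda>a. f' \<cdot>\<^bsub>C\<^esub> (e \<cdot>\<^bsub>C\<^esub> a)) as'"
      "f \<cdot>\<^bsub>C\<^esub> m0 = f' \<cdot>\<^bsub>C\<^esub> m0"
    and dom: "map (\<lambda>a. Dom C (e \<cdot>\<^bsub>C\<^esub> a)) as = map (\<lambda>a. Dom C (e \<cdot>\<^bsub>C\<^esub> a)) as'"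
    using gtp unfolding gtp_eq_def by (auto simp: comp_def)
  obtain h where h: "h \<in> hom C (Dom C m) M0" "e \<cdot>\<^bsub>C\<^esub> m = m0 \<cdot>\<^bsub>C\<^esub> h"
    using fac N(3) Dom_comp[OF M(4) N(2)] unfolding factors_through_def hom_def by auto
  have m: "f \<cdot>\<^bsub>C\<^esub> (e \<cdot>\<^bsub>C\<^esub> m) = f' \<cdot>\<^bsub>C\<^esub> (e \<cdot>\<^bsub>C\<^esub> m)"
    using h eq(2) comp_assoc[OF hom_arrows_into[OF h(1)] N(3)] K(2,3) by metis
  have D: "map (\<lambda>a. Dom C (e \<cdot>\<^bsub>C\<^esub> a)) xs = map (Dom C) xs"
    if "set xs \<subseteq> arrows_into C M" for xs
    using that Dom_comp[OF _ N(2)] by auto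
  have A: "map (\<lambda>a. (g \<cdot>\<^bsub>C\<^esub> e) \<cdot>\<^bsub>C\<^esub> a) xs = map (\<lambda>a. g \<cdot>\<^bsub>C\<^esub> (e \<cdot>\<^bsub>C\<^esub> a)) xs"
    if "set xs \<subseteq> arrows_into C M" "g \<in> hom C N K" for xs g
    using that comp_assoc[OF _ N(2)] by auto
  have "map (\<lambda>a. (f \<cdot>\<^bsub>C\<^esub> e) \<cdot>\<^bsub>C\<^esub> a) (as @ [m]) = map (\<lambda>a. (f' \<cdot>\<^bsub>C\<^esub> e) \<cdot>\<^bsub>C\<^esub> a) (as' @ [m])"
    using A[of "as @ [m]" f] A[of "as' @ [m]" f'] M K eq m by auto
  moreover have "map (Dom C) (as @ [m]) = map (Dom C) (as' @ [m])"
    using D[OF M(2)] D[OF M(3)] dom by simp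
  ultimately show ?thesis
    unfolding gtp_eq_def
    using M K comp_hom[OF N(2) K(2)] comp_hom[OF N(2) K(3)] by auto
qed

text \<open>A chain of steps collapses because equality of Galois types is already
  transitive.\<close>

lemma Lgtp_eq_imp_gtp_eq:
  "Lgtp_eq C Ms M [m] as as' \<Longrightarrow> gtp_eq C Ms M (as @ [m]) M (as' @ [m])"
  unfolding Lgtp_eq_def
  by (induction rule: tranclp_induct) (blast intro: Lgtp_step_imp_gtp_eq gtp_eq_trans)+

text \<open>One step suffices: the extension is trivial, and \<open>m\<close> itself serves as the
  arrow from a model through which the base must factor.\<close>

lemma gtp_eq_imp_Lgtp_eq:
  assumes "gtp_eq C Ms M (as @ [m]) M (as' @ [m])" "Dom C m \<in> Ms"
  shows "Lgtp_eq C Ms M [m] as as'"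
proof -
  have M: "M \<in> Ms" "set as \<subseteq> arrows_into C M" "set as' \<subseteq> arrows_into C M" "m \<in> arrows_into C M"
    using assms unfolding gtp_eq_def by auto
  have I: "map (\<lambda>a. Ident C M \<cdot>\<^bsub>C\<^esub> a) xs = xs" if "set xs \<subseteq> arrows_into C M" for xs
    using that Ident_comp by (auto intro!: map_idI)
  have "factors_through C (Ident C M \<cdot>\<^bsub>C\<^esub> m) m"
    unfolding Ident_comp[OF M(4)] factors_through_def
    using comp_Ident[OF M(4)] Ident_hom assms(2) models_Obj by (metis subsetD)
  moreover have "gtp_eq C Ms M (map (\<lambda>a. Ident C M \<cdot>\<^bsub>C\<^esub> a) as @ [m])
      M (map (\<lambda>a. Ident C M \<cdot>\<^bsub>C\<^esub> a) as' @ [m])"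
    using assms(1) I M by simp
  moreover have "Ident C M \<in> hom C M M"
    using Ident_hom M(1) models_Obj by auto
  ultimately have "Lgtp_step C Ms M [m] as as'"
    unfolding Lgtp_step_def using M assms(2) arrows_into_hom[OF M(4)] by auto
  then show ?thesis
    unfolding Lgtp_eq_def by blast
qed

end

section \<open>Independence relations and the two implications\<close>

locale independence_category = amalgamation_category C Ms
  for C :: "('o, 'a) category" and Ms :: "'o set" +
  fixes base :: "'o set" and ind :: "('o, 'a) indep"
  assumes independence: "independence_relation C Ms base ind"
    and invariance: "ind_invariance C Ms ind"
    and monotonicity: "ind_monotonicity C ind"
    and symmetry: "ind_symmetry ind"
begin

lemma ind_arrows:
  assumes "ind M a c b"
  shows "M \<in> Ms" "a \<in> arrows_into C M" "c \<in> arrows_into C M" "b \<in> arrows_into C M"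
  using assms independence unfolding independence_relation_def by blast+

lemma ind_sym: "ind M a c b \<Longrightarrow> ind M b c a"
  using symmetry unfolding ind_symmetry_def by blast

text \<open>A triple in \<open>M\<close> and its image in \<open>N\<close> have the same Galois
  type, so this is an instance of Invariance.\<close>

lemma ind_extend:
  assumes "ind M a c b" "f \<in> hom C M N" "N \<in> Ms"
  shows "ind N (f \<cdot>\<^bsub>C\<^esub> a) (f \<cdot>\<^bsub>C\<^esub> c) (f \<cdot>\<^bsub>C\<^esub> b)"
proof -
  have "gtp_eq C Ms M [a, b, c] N (map (\<lambda>a. f \<cdot>\<^bsub>C\<^esub> a) [a, b, c])"
    using ind_arrows[OF assms(1)] by (intro gtp_eq_extend assms) auto
  then show ?thesis
    using invariance assms(1) unfolding ind_invariance_def by auto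
qed

text \<open>Monotonicity shrinks the left side; Symmetry, applied before and after, carries it over
  to the right side.\<close>

lemma ind_comp_right:
  assumes "ind M a c b" "h \<in> hom C X (Dom C b)"
  shows "ind M a c (b \<cdot>\<^bsub>C\<^esub> h)"
proof -
  have b: "b \<in> hom C (Dom C b) M"
    using ind_arrows[OF assms(1)] arrows_into_hom by blast
  have bh: "b \<cdot>\<^bsub>C\<^esub> h \<in> hom C X M"
    using comp_hom[OF assms(2) b] .
  then have "factors_through C (b \<cdot>\<^bsub>C\<^esub> h) b"
    using assms(2) unfolding factors_through_def hom_def by auto
  then show ?thesis
    using ind_sym[OF assms(1)] hom_arrows_into[OF bh] monotonicity ind_sym
    unfolding ind_monotonicity_def by blast
qed

lemma three_amalgamation_if_independence_theorem:
  assumes it: "independence_theorem_over_models C Ms ind"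
  shows "three_amalgamation C Ms ind"
  unfolding three_amalgamation_def
proof (intro ballI impI)
  fix M N1 N2 N3 A B X a1 a3 b1 b2 c2 c3 m1 m2 m3
  assume Ms: "M \<in> Ms" "N1 \<in> Ms" "N2 \<in> Ms" "N3 \<in> Ms"
    and a: "a1 \<in> hom C A N1" "a3 \<in> hom C A N3"
    and b: "b1 \<in> hom C B N1" "b2 \<in> hom C B N2"
    and c: "c2 \<in> hom C X N2" "c3 \<in> hom C X N3"
    and m: "m1 \<in> hom C M N1" "m2 \<in> hom C M N2" "m3 \<in> hom C M N3"
    and ind: "ind N1 a1 m1 b1" "ind N2 b2 m2 c2" "ind N3 c3 m3 a3"
    and gtp: "gtp_eq C Ms N1 [a1, m1] N3 [a3, m3]" "gtp_eq C Ms N1 [b1, m1] N2 [b2, m2]"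
      "gtp_eq C Ms N2 [c2, m2] N3 [c3, m3]"
  note into = hom_arrows_into[OF a(1)] hom_arrows_into[OF a(2)] hom_arrows_into[OF b(1)]
    hom_arrows_into[OF b(2)] hom_arrows_into[OF c(1)] hom_arrows_into[OF c(2)]
    hom_arrows_into[OF m(1)] hom_arrows_into[OF m(2)] hom_arrows_into[OF m(3)]
  \<comment> \<open>The equality of the types of \<open>b1\<close> and \<open>b2\<close> glues
    \<open>N1\<close> and \<open>N2\<close> along \<open>M\<close> and \<open>B\<close>.\<close>
  obtain K g1 g2 where K: "K \<in> Ms" "g1 \<in> hom C N1 K" "g2 \<in> hom C N2 K"
    and Keq: "g1 \<cdot>\<^bsub>C\<^esub> b1 = g2 \<cdot>\<^bsub>C\<^esub> b2" "g1 \<cdot>\<^bsub>C\<^esub> m1 = g2 \<cdot>\<^bsub>C\<^esub> m2"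
    using gtp(2) unfolding gtp_eq_def by auto
  \<comment> \<open>The type of \<open>c2\<close> does not change in \<open>K\<close>, so
    \<open>N3\<close> can be glued on along \<open>M\<close> and \<open>X\<close>. Nothing forces
    the images of \<open>a1\<close> and \<open>a3\<close> in the resulting model \<open>L\<close> to
    coincide.\<close>
  have "gtp_eq C Ms K [g2 \<cdot>\<^bsub>C\<^esub> c2, g2 \<cdot>\<^bsub>C\<^esub> m2] N3 [c3, m3]"
    using gtp_eq_trans[OF gtp_eq_sym[OF gtp_eq_extend[OF Ms(3) K(1,3)]] gtp(3)] into by auto
  then obtain L h h3 where L: "L \<in> Ms" "h \<in> hom C K L" "h3 \<in> hom C N3 L"
    and Leq: "h \<cdot>\<^bsub>C\<^esub> (g2 \<cdot>\<^bsub>C\<^esub> c2) = h3 \<cdot>\<^bsub>C\<^esub> c3" "h \<cdot>\<^bsub>C\<^esub> (g2 \<cdot>\<^bsub>C\<^esub> m2) = h3 \<cdot>\<^bsub>C\<^esub> m3"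
    unfolding gtp_eq_def by auto
  define h1 where "h1 = h \<cdot>\<^bsub>C\<^esub> g1"
  define h2 where "h2 = h \<cdot>\<^bsub>C\<^esub> g2"
  have h12: "h1 \<in> hom C N1 L" "h2 \<in> hom C N2 L"
    unfolding h1_def h2_def using comp_hom K L by blast+
  have eqs: "h1 \<cdot>\<^bsub>C\<^esub> b1 = h2 \<cdot>\<^bsub>C\<^esub> b2" "h1 \<cdot>\<^bsub>C\<^esub> m1 = h2 \<cdot>\<^bsub>C\<^esub> m2"
    "h3 \<cdot>\<^bsub>C\<^esub> c3 = h2 \<cdot>\<^bsub>C\<^esub> c2" "h3 \<cdot>\<^bsub>C\<^esub> m3 = h2 \<cdot>\<^bsub>C\<^esub> m2"
    unfolding h1_def h2_def using comp_assoc[OF _ K(2) L(2)] comp_assoc[OF _ K(3) L(2)] into Keq Leq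
    by simp_all
  define m where "m = h2 \<cdot>\<^bsub>C\<^esub> m2"
  have m_hom: "m \<in> hom C M L"
    unfolding m_def using comp_hom m(2) h12(2) by blast
  then have Dom_m: "Dom C m = M" and m_Arr: "m \<in> Arr C"
    unfolding hom_def by auto
  \<comment> \<open>The Independence Theorem will be applied in \<open>L\<close> with base
    \<open>m\<close>, the common image of \<open>M\<close>. The images of \<open>a1\<close> and
    \<open>a3\<close> play the roles of \<open>a\<close> and \<open>a'\<close>, those of
    \<open>b2\<close> and \<open>c2\<close> the roles of \<open>b\<close> and
    \<open>b'\<close>.\<close>
  have i1: "ind L (h1 \<cdot>\<^bsub>C\<^esub> a1) m (h2 \<cdot>\<^bsub>C\<^esub> b2)"
    using ind_extend[OF ind(1) h12(1) L(1)] eqs m_def by simp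
  have i2: "ind L (h2 \<cdot>\<^bsub>C\<^esub> b2) m (h2 \<cdot>\<^bsub>C\<^esub> c2)"
    using ind_extend[OF ind(2) h12(2) L(1)] eqs m_def by simp
  have i3: "ind L (h3 \<cdot>\<^bsub>C\<^esub> a3) m (h2 \<cdot>\<^bsub>C\<^esub> c2)"
    using ind_extend[OF ind_sym[OF ind(3)] L(3) L(1)] eqs m_def by simp
  \<comment> \<open>The two copies of \<open>A\<close> in \<open>L\<close> are compared through
    their originals in \<open>N1\<close> and \<open>N3\<close>. As the domain of \<open>m\<close> is
    the model \<open>M\<close>, the resulting Galois equality is also a Lascar equality.\<close>
  have "gtp_eq C Ms L [h1 \<cdot>\<^bsub>C\<^esub> a1, m] N3 [a3, m3]"
    using gtp_eq_trans[OF gtp_eq_sym[OF gtp_eq_extend[OF Ms(2) L(1) h12(1)]] gtp(1)]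
      into eqs m_def by auto
  moreover have "gtp_eq C Ms N3 [a3, m3] L [h3 \<cdot>\<^bsub>C\<^esub> a3, m]"
    using gtp_eq_extend[OF Ms(4) L(1,3), of "[a3, m3]"] into eqs m_def by auto
  ultimately have "gtp_eq C Ms L ([h1 \<cdot>\<^bsub>C\<^esub> a1] @ [m]) L ([h3 \<cdot>\<^bsub>C\<^esub> a3] @ [m])"
    using gtp_eq_trans by fastforce
  then have "Lgtp_eq C Ms L [m] [h1 \<cdot>\<^bsub>C\<^esub> a1] [h3 \<cdot>\<^bsub>C\<^esub> a3]"
    using gtp_eq_imp_Lgtp_eq Dom_m Ms(1) by blast
  moreover have "independence_theorem_at C Ms ind m"
    using it m_Arr Dom_m Ms(1) unfolding independence_theorem_over_models_def by blast
  ultimately obtain P e a0 where P: "P \<in> Ms" "e \<in> hom C L P" "a0 \<in> arrows_into C P"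
    and lgtp: "Lgtp_eq C Ms P [e \<cdot>\<^bsub>C\<^esub> m] [a0, e \<cdot>\<^bsub>C\<^esub> (h2 \<cdot>\<^bsub>C\<^esub> b2)] [e \<cdot>\<^bsub>C\<^esub> (h1 \<cdot>\<^bsub>C\<^esub> a1), e \<cdot>\<^bsub>C\<^esub> (h2 \<cdot>\<^bsub>C\<^esub> b2)]"
      "Lgtp_eq C Ms P [e \<cdot>\<^bsub>C\<^esub> m] [a0, e \<cdot>\<^bsub>C\<^esub> (h2 \<cdot>\<^bsub>C\<^esub> c2)] [e \<cdot>\<^bsub>C\<^esub> (h3 \<cdot>\<^bsub>C\<^esub> a3), e \<cdot>\<^bsub>C\<^esub> (h2 \<cdot>\<^bsub>C\<^esub> c2)]"
    and i0: "ind P a0 (e \<cdot>\<^bsub>C\<^esub> m) e"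
    using i1 i2 i3 unfolding independence_theorem_at_def by blast
  define e1 where "e1 = e \<cdot>\<^bsub>C\<^esub> h1"
  define e2 where "e2 = e \<cdot>\<^bsub>C\<^esub> h2"
  define e3 where "e3 = e \<cdot>\<^bsub>C\<^esub> h3"
  have e123: "e1 \<in> hom C N1 P" "e2 \<in> hom C N2 P" "e3 \<in> hom C N3 P"
    unfolding e1_def e2_def e3_def using comp_hom h12 L(3) P(2) by blast+
  have e1: "e1 \<cdot>\<^bsub>C\<^esub> x = e \<cdot>\<^bsub>C\<^esub> (h1 \<cdot>\<^bsub>C\<^esub> x)" if "x \<in> arrows_into C N1" for x
    unfolding e1_def using comp_assoc[OF that h12(1) P(2)] .
  have e2: "e2 \<cdot>\<^bsub>C\<^esub> x = e \<cdot>\<^bsub>C\<^esub> (h2 \<cdot>\<^bsub>C\<^esub> x)" if "x \<in> arrows_into C N2" for x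
    unfolding e2_def using comp_assoc[OF that h12(2) P(2)] .
  have e3: "e3 \<cdot>\<^bsub>C\<^esub> x = e \<cdot>\<^bsub>C\<^esub> (h3 \<cdot>\<^bsub>C\<^esub> x)" if "x \<in> arrows_into C N3" for x
    unfolding e3_def using comp_assoc[OF that L(3) P(2)] .
  have em: "e \<cdot>\<^bsub>C\<^esub> m = e2 \<cdot>\<^bsub>C\<^esub> m2"
    unfolding m_def using e2 into by simp
  \<comment> \<open>The Lascar equality is weakened to a Galois one that includes the base, and then
    pulled back along \<open>e1\<close> to \<open>N1\<close>. In this form it supplies a new
    embedding of \<open>N1\<close> taking \<open>a1\<close> to the image of
    \<open>a0\<close>.\<close>
  have t1: "gtp_eq C Ms P [a0, e2 \<cdot>\<^bsub>C\<^esub> b2, e2 \<cdot>\<^bsub>C\<^esub> m2] N1 [a1, b1, m1]"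
  proof -
    have "gtp_eq C Ms P [a0, e2 \<cdot>\<^bsub>C\<^esub> b2, e2 \<cdot>\<^bsub>C\<^esub> m2] P [e1 \<cdot>\<^bsub>C\<^esub> a1, e1 \<cdot>\<^bsub>C\<^esub> b1, e1 \<cdot>\<^bsub>C\<^esub> m1]"
      using Lgtp_eq_imp_gtp_eq[OF lgtp(1)] e1 e2 into eqs m_def by simp
    then show ?thesis
      using gtp_eq_trans gtp_eq_sym[OF gtp_eq_extend[OF Ms(2) P(1) e123(1), of "[a1, b1, m1]"]] into
      by fastforce
  qed
  have t3: "gtp_eq C Ms P [a0, e2 \<cdot>\<^bsub>C\<^esub> c2, e2 \<cdot>\<^bsub>C\<^esub> m2] N3 [a3, c3, m3]"
  proof -
    have "gtp_eq C Ms P [a0, e2 \<cdot>\<^bsub>C\<^esub> c2, e2 \<cdot>\<^bsub>C\<^esub> m2] P [e3 \<cdot>\<^bsub>C\<^esub> a3, e3 \<cdot>\<^bsub>C\<^esub> c3, e3 \<cdot>\<^bsub>C\<^esub> m3]"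
      using Lgtp_eq_imp_gtp_eq[OF lgtp(2)] e3 e2 into eqs m_def by simp
    then show ?thesis
      using gtp_eq_trans gtp_eq_sym[OF gtp_eq_extend[OF Ms(4) P(1) e123(3), of "[a3, c3, m3]"]] into
      by fastforce
  qed
  \<comment> \<open>The embedding \<open>k1\<close> takes over from \<open>e1\<close>, and below
    \<open>l3\<close> from \<open>e3\<close>; both agree with the image of \<open>N2\<close> on the
    shared parts, and both hit the image of \<open>a0\<close>.\<close>
  obtain Q k k1 where Q: "Q \<in> Ms" "k \<in> hom C P Q" "k1 \<in> hom C N1 Q"
    and Qeq: "k \<cdot>\<^bsub>C\<^esub> a0 = k1 \<cdot>\<^bsub>C\<^esub> a1" "k \<cdot>\<^bsub>C\<^esub> (e2 \<cdot>\<^bsub>C\<^esub> b2) = k1 \<cdot>\<^bsub>C\<^esub> b1"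
      "k \<cdot>\<^bsub>C\<^esub> (e2 \<cdot>\<^bsub>C\<^esub> m2) = k1 \<cdot>\<^bsub>C\<^esub> m1"
    using t1 unfolding gtp_eq_def by auto
  obtain R l l3 where R: "R \<in> Ms" "l \<in> hom C P R" "l3 \<in> hom C N3 R"
    and Req: "l \<cdot>\<^bsub>C\<^esub> a0 = l3 \<cdot>\<^bsub>C\<^esub> a3" "l \<cdot>\<^bsub>C\<^esub> (e2 \<cdot>\<^bsub>C\<^esub> c2) = l3 \<cdot>\<^bsub>C\<^esub> c3"
      "l \<cdot>\<^bsub>C\<^esub> (e2 \<cdot>\<^bsub>C\<^esub> m2) = l3 \<cdot>\<^bsub>C\<^esub> m3"
    using t3 unfolding gtp_eq_def by auto
  \<comment> \<open>Amalgamating over \<open>P\<close> gives \<open>a0\<close> and the image of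
    \<open>N2\<close> a single image \<open>s\<close> in \<open>N\<close>, so the identities
    obtained in \<open>Q\<close> and in \<open>R\<close> can be combined.\<close>
  obtain N p q where N: "N \<in> Ms" "p \<in> hom C Q N" "q \<in> hom C R N" "p \<cdot>\<^bsub>C\<^esub> k = q \<cdot>\<^bsub>C\<^esub> l"
    using amalgamate[OF Q(2) R(2) P(1) Q(1) R(1)] by blast
  define s where "s = p \<cdot>\<^bsub>C\<^esub> k"
  have s_hom: "s \<in> hom C P N"
    unfolding s_def using comp_hom Q(2) N(2) by blast
  have s1: "s \<cdot>\<^bsub>C\<^esub> x = p \<cdot>\<^bsub>C\<^esub> (k \<cdot>\<^bsub>C\<^esub> x)" and s3: "s \<cdot>\<^bsub>C\<^esub> x = q \<cdot>\<^bsub>C\<^esub> (l \<cdot>\<^bsub>C\<^esub> x)"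
    if "x \<in> arrows_into C P" for x
    using comp_assoc[OF that Q(2) N(2)] comp_assoc[OF that R(2) N(3)] N(4) s_def by simp_all
  define f1 where "f1 = p \<cdot>\<^bsub>C\<^esub> k1"
  define f2 where "f2 = s \<cdot>\<^bsub>C\<^esub> e2"
  define f3 where "f3 = q \<cdot>\<^bsub>C\<^esub> l3"
  have f: "f1 \<in> hom C N1 N" "f2 \<in> hom C N2 N" "f3 \<in> hom C N3 N"
    unfolding f1_def f2_def f3_def using comp_hom Q R N s_hom e123 by blast+
  have f1: "f1 \<cdot>\<^bsub>C\<^esub> x = p \<cdot>\<^bsub>C\<^esub> (k1 \<cdot>\<^bsub>C\<^esub> x)" if "x \<in> arrows_into C N1" for x
    unfolding f1_def using comp_assoc[OF that Q(3) N(2)] .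
  have f2: "f2 \<cdot>\<^bsub>C\<^esub> x = s \<cdot>\<^bsub>C\<^esub> (e2 \<cdot>\<^bsub>C\<^esub> x)" if "x \<in> arrows_into C N2" for x
    unfolding f2_def using comp_assoc[OF that e123(2) s_hom] .
  have f3: "f3 \<cdot>\<^bsub>C\<^esub> x = q \<cdot>\<^bsub>C\<^esub> (l3 \<cdot>\<^bsub>C\<^esub> x)" if "x \<in> arrows_into C N3" for x
    unfolding f3_def using comp_assoc[OF that R(3) N(3)] .
  have e2_into: "e2 \<cdot>\<^bsub>C\<^esub> x \<in> arrows_into C P" if "x \<in> arrows_into C N2" for x
    using comp_arrows_into[OF that e123(2)] .
  have a0: "f1 \<cdot>\<^bsub>C\<^esub> a1 = s \<cdot>\<^bsub>C\<^esub> a0" "f3 \<cdot>\<^bsub>C\<^esub> a3 = s \<cdot>\<^bsub>C\<^esub> a0"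
    using f1 f3 into s1[OF P(3)] s3[OF P(3)] Qeq Req by simp_all
  have m_eq: "f1 \<cdot>\<^bsub>C\<^esub> m1 = f2 \<cdot>\<^bsub>C\<^esub> m2" "f2 \<cdot>\<^bsub>C\<^esub> m2 = f3 \<cdot>\<^bsub>C\<^esub> m3"
    using f1 f2 f3 into s1[OF e2_into] s3[OF e2_into] Qeq Req by metis+
  have bc_eq: "f1 \<cdot>\<^bsub>C\<^esub> b1 = f2 \<cdot>\<^bsub>C\<^esub> b2" "f2 \<cdot>\<^bsub>C\<^esub> c2 = f3 \<cdot>\<^bsub>C\<^esub> c3"
    using f1 f2 f3 into s1[OF e2_into] s3[OF e2_into] Qeq Req by metis+
  \<comment> \<open>The independence of \<open>a0\<close> from all of \<open>L\<close> is restricted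
    to \<open>N2\<close>, since \<open>e2\<close> factors through \<open>e\<close> by way of
    \<open>h2\<close>.\<close>
  have "ind P a0 (e2 \<cdot>\<^bsub>C\<^esub> m2) e2"
    using ind_comp_right[OF i0] h12(2) P(2) em unfolding e2_def hom_def by auto
  then have "ind N (f1 \<cdot>\<^bsub>C\<^esub> a1) (f1 \<cdot>\<^bsub>C\<^esub> m1) f2"
    using ind_extend[OF _ s_hom N(1)] a0 m_eq f2 into f2_def by metis
  then show "\<exists>N\<in>Ms. \<exists>f1\<in>hom C N1 N. \<exists>f2\<in>hom C N2 N. \<exists>f3\<in>hom C N3 N.
      f1 \<cdot>\<^bsub>C\<^esub> m1 = f2 \<cdot>\<^bsub>C\<^esub> m2 \<and> f2 \<cdot>\<^bsub>C\<^esub> m2 = f3 \<cdot>\<^bsub>C\<^esub> m3 \<and>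
      f1 \<cdot>\<^bsub>C\<^esub> a1 = f3 \<cdot>\<^bsub>C\<^esub> a3 \<and> f1 \<cdot>\<^bsub>C\<^esub> b1 = f2 \<cdot>\<^bsub>C\<^esub> b2 \<and> f2 \<cdot>\<^bsub>C\<^esub> c2 = f3 \<cdot>\<^bsub>C\<^esub> c3 \<and>
      ind N (f1 \<cdot>\<^bsub>C\<^esub> a1) (f1 \<cdot>\<^bsub>C\<^esub> m1) f2"
    using N(1) f m_eq a0 bc_eq by metis
qed

lemma independence_theorem_if_three_amalgamation:
  assumes ta: "three_amalgamation C Ms ind"
  shows "independence_theorem_over_models C Ms ind"
  unfolding independence_theorem_over_models_def independence_theorem_at_def
proof (intro ballI allI impI)
  fix c M a a' b b'
  assume c: "c \<in> Arr C" "Dom C c \<in> Ms"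
    and ind: "ind M a c b" "ind M a' c b'" "ind M b c b'"
    and lgtp: "Lgtp_eq C Ms M [c] [a] [a']"
  note M = ind_arrows[OF ind(1)] ind_arrows(2,4)[OF ind(2)]
  have gtp: "gtp_eq C Ms M [a, c] M [a', c]"
    using Lgtp_eq_imp_gtp_eq[OF lgtp] by simp
  then have dom: "Dom C a' = Dom C a"
    unfolding gtp_eq_def by auto
  have homs: "a \<in> hom C (Dom C a) M" "a' \<in> hom C (Dom C a) M" "b \<in> hom C (Dom C b) M"
    "b' \<in> hom C (Dom C b') M" "c \<in> hom C (Dom C c) M"
    using M arrows_into_hom dom by metis+
  have objs: "Dom C a \<in> Obj C" "Dom C b \<in> Obj C" "Dom C b' \<in> Obj C"
    using M category unfolding is_category_def arrows_into_def by auto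
  \<comment> \<open>In the instance below, \<open>b1\<close> and \<open>b2\<close> are both
    \<open>b\<close>, while \<open>c2\<close> and \<open>c3\<close> are both \<open>b'\<close>;
    their type conditions are reflexivity, and only the one for \<open>a\<close> and
    \<open>a'\<close> has content.\<close>
  have refl: "gtp_eq C Ms M [x, c] M [x, c]" if "x \<in> arrows_into C M" for x
  proof -
    have "gtp_eq C Ms M [x, c] M (map (\<lambda>a. Ident C M \<cdot>\<^bsub>C\<^esub> a) [x, c])"
      using that M models_Obj by (intro gtp_eq_extend Ident_hom) auto
    from gtp_eq_trans[OF this gtp_eq_sym[OF this]] show ?thesis .
  qed
  obtain N f1 f2 f3 where N: "N \<in> Ms" "f1 \<in> hom C M N" "f2 \<in> hom C M N" "f3 \<in> hom C M N"
    and eqs: "f1 \<cdot>\<^bsub>C\<^esub> c = f2 \<cdot>\<^bsub>C\<^esub> c" "f2 \<cdot>\<^bsub>C\<^esub> c = f3 \<cdot>\<^bsub>C\<^esub> c" "f1 \<cdot>\<^bsub>C\<^esub> a = f3 \<cdot>\<^bsub>C\<^esub> a'"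
      "f1 \<cdot>\<^bsub>C\<^esub> b = f2 \<cdot>\<^bsub>C\<^esub> b" "f2 \<cdot>\<^bsub>C\<^esub> b' = f3 \<cdot>\<^bsub>C\<^esub> b'"
    and i: "ind N (f1 \<cdot>\<^bsub>C\<^esub> a) (f1 \<cdot>\<^bsub>C\<^esub> c) f2"
    using ta[unfolded three_amalgamation_def, rule_format, OF c(2) M(1) M(1) M(1) objs
        homs(1,2,3,3,4,4,5,5,5) ind(1,3) ind_sym[OF ind(2)] gtp refl[OF M(4)] refl[OF M(6)]]
    by blast
  \<comment> \<open>Both tuples have the type of \<open>[x, y, c]\<close> in \<open>M\<close>. The
    pair \<open>f1\<close>, \<open>f2\<close> handles \<open>b\<close>, because \<open>f1\<close>
    and \<open>f2\<close> agree on \<open>b\<close>; the pair \<open>f3\<close>, \<open>f2\<close>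
    handles \<open>b'\<close>, because \<open>f3\<close> takes \<open>a'\<close> to the image of
    \<open>a\<close> under \<open>f1\<close> and agrees with \<open>f2\<close> on
    \<open>b'\<close>.\<close>
  have ext: "gtp_eq C Ms N [f \<cdot>\<^bsub>C\<^esub> x, f \<cdot>\<^bsub>C\<^esub> y, f \<cdot>\<^bsub>C\<^esub> c] N [g \<cdot>\<^bsub>C\<^esub> x, g \<cdot>\<^bsub>C\<^esub> y, g \<cdot>\<^bsub>C\<^esub> c]"
    if "f \<in> hom C M N" "g \<in> hom C M N" "x \<in> arrows_into C M" "y \<in> arrows_into C M" for f g x y
    using gtp_eq_trans[OF gtp_eq_sym[OF gtp_eq_extend[OF M(1) N(1) that(1)]]
        gtp_eq_extend[OF M(1) N(1) that(2)], of "[x, y, c]"] that M by auto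
  have Dom: "Dom C (f2 \<cdot>\<^bsub>C\<^esub> c) \<in> Ms"
    using Dom_comp[OF M(3) N(3)] c(2) by simp
  have "Lgtp_eq C Ms N [f2 \<cdot>\<^bsub>C\<^esub> c] [f1 \<cdot>\<^bsub>C\<^esub> a, f2 \<cdot>\<^bsub>C\<^esub> b] [f2 \<cdot>\<^bsub>C\<^esub> a, f2 \<cdot>\<^bsub>C\<^esub> b]"
    using gtp_eq_imp_Lgtp_eq[OF _ Dom] ext[OF N(2,3) M(2,4)] eqs by simp
  moreover have "Lgtp_eq C Ms N [f2 \<cdot>\<^bsub>C\<^esub> c] [f1 \<cdot>\<^bsub>C\<^esub> a, f2 \<cdot>\<^bsub>C\<^esub> b'] [f2 \<cdot>\<^bsub>C\<^esub> a', f2 \<cdot>\<^bsub>C\<^esub> b']"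
    using gtp_eq_imp_Lgtp_eq[OF _ Dom] ext[OF N(4,3) M(5,6)] eqs by simp
  ultimately show "\<exists>N\<in>Ms. \<exists>e\<in>hom C M N. \<exists>a0\<in>arrows_into C N.
      Lgtp_eq C Ms N [e \<cdot>\<^bsub>C\<^esub> c] [a0, e \<cdot>\<^bsub>C\<^esub> b] [e \<cdot>\<^bsub>C\<^esub> a, e \<cdot>\<^bsub>C\<^esub> b] \<and>
      Lgtp_eq C Ms N [e \<cdot>\<^bsub>C\<^esub> c] [a0, e \<cdot>\<^bsub>C\<^esub> b'] [e \<cdot>\<^bsub>C\<^esub> a', e \<cdot>\<^bsub>C\<^esub> b'] \<and>
      ind N a0 (e \<cdot>\<^bsub>C\<^esub> c) e"
    using N i eqs(1) comp_arrows_into[OF M(2) N(2)] by metis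
qed

end

theorem theorem5p2:
  fixes C :: "('o, 'a) category" and Ms base :: "'o set" and ind :: "('o, 'a) indep"
  assumes "AECat TYPE('u) C Ms"
    and "amalgamation_property C Ms"
    and "basic_independence_relation TYPE('u) C Ms base ind"
  shows "(independence_theorem C Ms ind \<longrightarrow> three_amalgamation C Ms ind) \<and>
    (three_amalgamation C Ms ind \<longrightarrow> independence_theorem_over_models C Ms ind)"
proof -
  interpret independence_category C Ms base ind
    using assms
    unfolding AECat_def accessible_def basic_independence_relation_def
    by unfold_locales auto
  \<comment> \<open>Specialising to bases whose domain is a model gives the form from which
    3-amalgamation was derived.\<close>
  have "independence_theorem C Ms ind \<Longrightarrow> independence_theorem_over_models C Ms ind"
    unfolding independence_theorem_def independence_theorem_over_models_def by blast
  then show ?thesis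
    using three_amalgamation_if_independence_theorem independence_theorem_if_three_amalgamation
    by blast
qed

end
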